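(* Let $n\ge3$, let $(\Omega,\mu,W)$ be any graphon and let $\rho_n\in(0,1]$ satisfy $$\rho_n\ge2\sqrt{\frac{\log n}{n-2}} .$$ Let $(\omega_1,\dots,\omega_n,A)$ be generated by the sparse $W$-random graph model on $n$ nodes with parameters $(\Omega,\mu,W)$ and $\rho_n$. For each $i$ let $m(i)\in\operatorname{argmin}_{t\ne i}r_W(\omega_i,\omega_t)$. Then, with probability at least $1-\frac2n$ under $\mathbb{P}_{(\Omega,\mu,W),\rho_n}$, the inequalities $$\left|\rho_n^2r_W^2(\omega_i,\omega_j)-\widehat r^{\,2}(i,j)\right|\le3\rho_n\Big(\rho_n r_W(\omega_j,\omega_{m(j)})+\rho_n r_W(\omega_i,\omega_{m(i)})+20\sqrt{\frac{\log n}{n}}\Big)$$ hold simultaneously for all $i,j\in[n]$ with $i\ne j$.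
   Context: A graphon is a triplet $(\Omega,\mu,W)$ where $\Omega$ is a measurable space, $\mu$ a probability measure on $\Omega$ and $W:\Omega\times\Omega\to[0,1]$ a symmetric measurable function. Neighborhood distance: $r_W(\omega,\omega')=\big(\int_\Omega |W(\omega,z)-W(\omega',z)|^2\mu(dz)\big)^{1/2}$. Sparse $W$-random graph model: $\omega_1,\dots,\omega_n$ are i.i.d. with law $\mu$ (unobserved); a graph is generated where, conditionally on the $\omega$'s, edges $(i,j)$, $i<j$, are independently present with probability $W(\omega_i,\omega_j)$, and then each edge is independently retained with probability $\rho_n$ and erased with probability $1-\rho_n$. Equivalently, conditionally on the $\omega$'s, $A_{ij}$, $i<j$, are independent Bernoulli with parameters $\rho_nW(\omega_i,\omega_j)$; $A_{ji}=A_{ij}$, $A_{ii}=0$. $\mathbb{P}_{(\Omega,\mu,W),\rho_n}$ denotes the corresponding probability. Distance estimator: with $A_i$ the $i$-th row of $A$ and $\langle A_i,A_j\rangle_n=\frac1n\sum_{k=1}^n A_{ik}A_{jk}$, put $\widehat f(i,j)=\max_{k\ne i,j}|\langle A_k,A_i-A_j\rangle_n|$, $\widehat m(i)\in\operatorname{argmin}_{j\ne i}\widehat f(i,j)$ (ties broken arbitrarily), and $\widehat r^{\,2}(i,j)=\langle A_i,A_{\widehat m(i)}\rangle_n+\langle A_j,A_{\widehat m(j)}\rangle_n-2\langle A_i,A_j\rangle_n$ (a real number, not necessarily nonnegative). *)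

theory Defs
  imports "HOL-Probability.Probability"
begin

locale graphon = prob_space M for M :: "'a measure" +
  fixes W :: "'a \<Rightarrow> 'a \<Rightarrow> real"
  assumes W_measurable: "(\<lambda>(x, y). W x y) \<in> borel_measurable (M \<Otimes>\<^sub>M M)"
    and W_sym: "x \<in> space M \<Longrightarrow> y \<in> space M \<Longrightarrow> W x y = W y x"
    and W_range: "x \<in> space M \<Longrightarrow> y \<in> space M \<Longrightarrow> W x y \<in> {0..1}"

definition nbhd_dist :: "'a measure \<Rightarrow> ('a \<Rightarrow> 'a \<Rightarrow> real) \<Rightarrow> 'a \<Rightarrow> 'a \<Rightarrow> real" where
  "nbhd_dist M W x y = sqrt (\<integral>z. \<bar>W x z - W y z\<bar>\<^sup>2 \<partial>M)"

definition node_pairs :: "nat \<Rightarrow> (nat \<times> nat) set" where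
  "node_pairs n = {(i, j). 1 \<le> i \<and> i < j \<and> j \<le> n}"

text \<open>The conditional law of the edge indicators \<open>(i, j)\<close>, \<open>i < j\<close>, given the latent
  positions \<open>\<omega>\<close>: generating an edge with probability \<open>W (\<omega> i) (\<omega> j)\<close> and then retaining it with
  probability \<open>\<rho>\<close> is a single Bernoulli trial with the product as parameter.\<close>

definition edge_measure ::
    "nat \<Rightarrow> ('a \<Rightarrow> 'a \<Rightarrow> real) \<Rightarrow> real \<Rightarrow> (nat \<Rightarrow> 'a) \<Rightarrow> (nat \<times> nat \<Rightarrow> bool) measure" where
  "edge_measure n W \<rho> \<omega> =
     (\<Pi>\<^sub>M (i, j)\<in>node_pairs n. measure_pmf (bernoulli_pmf (\<rho> * W (\<omega> i) (\<omega> j))))"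

text \<open>The joint law of the latent positions and the edge indicators.\<close>

definition sparse_graphon_measure ::
    "nat \<Rightarrow> 'a measure \<Rightarrow> ('a \<Rightarrow> 'a \<Rightarrow> real) \<Rightarrow> real
      \<Rightarrow> ((nat \<Rightarrow> 'a) \<times> (nat \<times> nat \<Rightarrow> bool)) measure" where
  "sparse_graphon_measure n M W \<rho> =
     (\<Pi>\<^sub>M i\<in>{1..n}. M) \<bind> (\<lambda>\<omega>.
       distr (edge_measure n W \<rho> \<omega>)
         ((\<Pi>\<^sub>M i\<in>{1..n}. M) \<Otimes>\<^sub>M (\<Pi>\<^sub>M p\<in>node_pairs n. count_space UNIV))
         (\<lambda>e. (\<omega>, e)))"

definition adjacency :: "(nat \<times> nat \<Rightarrow> bool) \<Rightarrow> nat \<Rightarrow> nat \<Rightarrow> real" where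
  "adjacency e i j =
     (if i < j then of_bool (e (i, j)) else if j < i then of_bool (e (j, i)) else 0)"

definition inner_n :: "nat \<Rightarrow> (nat \<Rightarrow> real) \<Rightarrow> (nat \<Rightarrow> real) \<Rightarrow> real" where
  "inner_n n u v = (1 / real n) * (\<Sum>k=1..n. u k * v k)"

text \<open>The maximum is over a nonempty set only for \<open>n \<ge> 3\<close>.\<close>

definition f_hat :: "nat \<Rightarrow> (nat \<Rightarrow> nat \<Rightarrow> real) \<Rightarrow> nat \<Rightarrow> nat \<Rightarrow> real" where
  "f_hat n A i j = (MAX k\<in>{1..n} - {i, j}. \<bar>inner_n n (A k) (\<lambda>l. A i l - A j l)\<bar>)"

text \<open>Minimizers need not be unique, so the two choices of minimizers are predicates on selections
  rather than functions.\<close>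

definition nearest_selection ::
    "nat \<Rightarrow> 'a measure \<Rightarrow> ('a \<Rightarrow> 'a \<Rightarrow> real) \<Rightarrow> (nat \<Rightarrow> 'a) \<Rightarrow> (nat \<Rightarrow> nat) \<Rightarrow> bool" where
  "nearest_selection n M W \<omega> m \<longleftrightarrow>
     (\<forall>i\<in>{1..n}. is_arg_min (\<lambda>t. nbhd_dist M W (\<omega> i) (\<omega> t)) (\<lambda>t. t \<in> {1..n} - {i}) (m i))"

definition m_hat_selection :: "nat \<Rightarrow> (nat \<Rightarrow> nat \<Rightarrow> real) \<Rightarrow> (nat \<Rightarrow> nat) \<Rightarrow> bool" where
  "m_hat_selection n A mh \<longleftrightarrow>
     (\<forall>i\<in>{1..n}. is_arg_min (f_hat n A i) (\<lambda>j. j \<in> {1..n} - {i}) (mh i))"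

text \<open>The estimator of the squared distance; it may be negative.\<close>

definition r_hat_sq ::
    "nat \<Rightarrow> (nat \<Rightarrow> nat \<Rightarrow> real) \<Rightarrow> (nat \<Rightarrow> nat) \<Rightarrow> nat \<Rightarrow> nat \<Rightarrow> real" where
  "r_hat_sq n A mh i j =
     inner_n n (A i) (A (mh i)) + inner_n n (A j) (A (mh j)) - 2 * inner_n n (A i) (A j)"

end

theory Submission
  imports Defs
begin

text \<open>For \<open>i \<noteq> j\<close> the number of common neighbours of \<open>i\<close> and \<open>j\<close> is, conditionally on \<open>\<omega>\<^sub>i\<close> and \<open>\<omega>\<^sub>j\<close>, a
  sum of \<open>n - 2\<close> independent Bernoulli variables with parameter \<open>\<rho>\<^sup>2 \<langle>W\<^sub>i, W\<^sub>j\<rangle>\<close>, where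
  \<open>W\<^sub>i = W(\<omega>\<^sub>i, \<cdot>)\<close>. Since this parameter is at most \<open>\<rho>\<^sup>2\<close>, a Chernoff bound and a union bound
  over the pairs show that, with probability at least \<open>1 - 2/n\<close>, all \<open>\<langle>A\<^sub>i, A\<^sub>j\<rangle>\<close> with \<open>i \<noteq> j\<close> are within
  \<open>\<epsilon> = 5 \<rho> (ln n / n)\<^bsup>1/2\<^esup>\<close> of \<open>\<rho>\<^sup>2 \<langle>W\<^sub>i, W\<^sub>j\<rangle>\<close>.

  On this event, let \<open>m\<close> be the nearest neighbour of \<open>i\<close>, at distance \<open>r\<close>, and \<open>h\<close> the selected one.
  By minimality \<open>f(i, h) \<le> f(i, m) \<le> \<rho>\<^sup>2 r + 2 \<epsilon>\<close>; testing \<open>f(i, h)\<close> against the row of \<open>m\<close> bounds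
  \<open>\<rho>\<^sup>2 \<langle>W\<^sub>m, W\<^sub>i - W\<^sub>h\<rangle>\<close>, and by Cauchy-Schwarz \<open>W\<^sub>m\<close> may be replaced by \<open>W\<^sub>i\<close> at the cost of
  \<open>\<rho>\<^sup>2 r\<close>. Hence \<open>\<langle>A\<^sub>i, A\<^sub>h\<rangle>\<close> estimates the diagonal term \<open>\<rho>\<^sup>2 \<langle>W\<^sub>i, W\<^sub>i\<rangle>\<close>, which \<open>\<langle>A\<^sub>i, A\<^sub>i\<rangle>\<close> does not,
  up to \<open>2 \<rho>\<^sup>2 r + 5 \<epsilon>\<close>.\<close>

section \<open>Preliminaries: product integrals over disjoint pairs and an exponential
  inequality\<close>

text \<open>Disjoint pairs of coordinates are independent under a product of probability measures.
  The induction removes both coordinates of one pair from \<open>S\<close>, hence \<open>S\<close>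
  varies; coordinates outside all pairs integrate to 1. In \<open>edge_mgf\<close> the pairs are the
  two edges joining \<open>k\<close> to \<open>i\<close> and to \<open>j\<close>.\<close>

lemma (in product_prob_space) nn_integral_prod_pairs:
  assumes "finite K" "finite S"
    and "\<And>k. k \<in> K \<Longrightarrow> a k \<in> S \<and> b k \<in> S \<and> a k \<noteq> b k"
    and "disjoint_family_on (\<lambda>k. {a k, b k}) K"
    and "\<And>k. k \<in> K \<Longrightarrow> case_prod (f k) \<in> borel_measurable (M (a k) \<Otimes>\<^sub>M M (b k))"
  shows "(\<integral>\<^sup>+x. (\<Prod>k\<in>K. f k (x (a k)) (x (b k))) \<partial>PiM S M) =
    (\<Prod>k\<in>K. \<integral>\<^sup>+v. \<integral>\<^sup>+u. f k u v \<partial>M (a k) \<partial>M (b k))"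
  using assms
proof (induction K arbitrary: S rule: finite_induct)
  case empty
  interpret PI: prob_space "PiM S M" by (intro prob_space_PiM prob_space)
  show ?case by (simp add: PI.emeasure_space_1)
next
  case (insert k K)
  define J where "J = S - {a k, b k}"
  have S: "S = insert (a k) (insert (b k) J)" "a k \<notin> insert (b k) J" "b k \<notin> J" "finite J"
    using insert.prems by (auto simp: J_def)
  have J: "a l \<in> J \<and> b l \<in> J" if "l \<in> K" for l
  proof -
    have "{a l, b l} \<inter> {a k, b k} = {}"
      using insert.prems(3) insert.hyps that by (auto simp: disjoint_family_on_def)
    then show ?thesis using insert.prems(2) that by (auto simp: J_def)
  qed
  have [measurable]: "case_prod (f k) \<in> borel_measurable (M (a k) \<Otimes>\<^sub>M M (b k))"
    using insert.prems by simp
  have F[measurable]: "(\<lambda>x. f l (x (a l)) (x (b l))) \<in> borel_measurable (PiM T M)"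
    if "l \<in> insert k K" "a l \<in> T" "b l \<in> T" for l T
    using measurable_compose[OF measurable_Pair[OF measurable_component_singleton[OF that(2)]
        measurable_component_singleton[OF that(3)]] insert.prems(4)[OF that(1)]]
    by simp
  define G where "G = (\<lambda>x. \<Prod>l\<in>K. f l (x (a l)) (x (b l)))"
  have G[measurable]: "G \<in> borel_measurable (PiM T M)" if "J \<subseteq> T" for T
    unfolding G_def using that J by (intro borel_measurable_prod_ennreal F) auto
  \<comment> \<open>By disjointness the remaining factors ignore the two split-off coordinates, so
    \<open>G\<close> is constant in both inner integrals.\<close>
  have upd: "G (x(a k := u)) = G x" "G (x(b k := u)) = G x" for x u
  proof -
    have "a l \<noteq> a k" "b l \<noteq> a k" "a l \<noteq> b k" "b l \<noteq> b k" if "l \<in> K" for l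
      using J[OF that] S(2,3) by auto
    then show "G (x(a k := u)) = G x" "G (x(b k := u)) = G x"
      unfolding G_def by (auto intro!: prod.cong)
  qed
  have sect: "(\<lambda>u. f k u v) \<in> borel_measurable (M (a k))" if "v \<in> space (M (b k))" for v
    using measurable_compose[OF measurable_Pair2'[OF that] insert.prems(4)[of k]] by simp
  interpret ab: pair_sigma_finite "M (a k)" "M (b k)" ..
  have "(\<integral>\<^sup>+x. (\<Prod>l\<in>insert k K. f l (x (a l)) (x (b l))) \<partial>PiM S M) =
    (\<integral>\<^sup>+x. f k (x (a k)) (x (b k)) * G x \<partial>PiM (insert (a k) (insert (b k) J)) M)"
    using insert.hyps S(1) by (simp add: G_def)
  also have "\<dots> = (\<integral>\<^sup>+x. \<integral>\<^sup>+u. f k u (x (b k)) * G x \<partial>M (a k) \<partial>PiM (insert (b k) J) M)"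
    using S insert.prems(2)[of k] insert.prems(2)[of k, THEN conjunct2, THEN conjunct2, symmetric]
    by (subst product_nn_integral_insert) (auto simp: upd intro!: borel_measurable_times_ennreal F G)
  also have "\<dots> = (\<integral>\<^sup>+x. (\<integral>\<^sup>+u. f k u (x (b k)) \<partial>M (a k)) * G x \<partial>PiM (insert (b k) J) M)"
    by (intro nn_integral_cong nn_integral_multc) (auto simp: space_PiM intro!: sect)
  also have "\<dots> = (\<integral>\<^sup>+x. \<integral>\<^sup>+v. (\<integral>\<^sup>+u. f k u v \<partial>M (a k)) * G x \<partial>M (b k) \<partial>PiM J M)"
    using S
    by (subst product_nn_integral_insert) (auto simp: upd intro!: borel_measurable_times_ennreal G)
  also have "\<dots> = (\<integral>\<^sup>+x. (\<integral>\<^sup>+v. \<integral>\<^sup>+u. f k u v \<partial>M (a k) \<partial>M (b k)) * G x \<partial>PiM J M)"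
    by (intro nn_integral_cong nn_integral_multc) measurable
  also have "\<dots> = (\<integral>\<^sup>+v. \<integral>\<^sup>+u. f k u v \<partial>M (a k) \<partial>M (b k)) * (\<integral>\<^sup>+x. G x \<partial>PiM J M)"
    by (intro nn_integral_cmult G) simp
  also have "(\<integral>\<^sup>+x. G x \<partial>PiM J M) = (\<Prod>l\<in>K. \<integral>\<^sup>+v. \<integral>\<^sup>+u. f l u v \<partial>M (a l) \<partial>M (b l))"
    unfolding G_def
    using insert.prems J S
    by (intro insert.IH) (auto simp: disjoint_family_on_def)
  finally show ?case using insert.hyps by simp
qed

text \<open>For negative \<open>x\<close> the second-order lower bound on \<open>exp (- x)\<close>
  is multiplied by \<open>1 + x + x\<^sup>2\<close>; the product is at least 1, and dividing by
  \<open>exp (- x)\<close> gives the claim.\<close>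

lemma exp_le_quadratic:
  fixes x :: real
  assumes "\<bar>x\<bar> \<le> 1"
  shows "exp x \<le> 1 + x + x\<^sup>2"
proof (cases "x \<ge> 0")
  case True
  then show ?thesis using exp_bound assms by auto
next
  case False
  have "1 \<le> (1 + x + x\<^sup>2) * (1 - x + x\<^sup>2 / 2)"
  proof -
    have "(1 + x + x\<^sup>2) * (1 - x + x\<^sup>2 / 2) - 1 = x\<^sup>2 / 2 * (1 - x + x\<^sup>2)"
      by (simp add: field_simps power2_eq_square)
    also have "\<dots> \<ge> 0" using False by simp
    finally show ?thesis by simp
  qed
  also have "\<dots> \<le> (1 + x + x\<^sup>2) * exp (- x)"
    using exp_lower_Taylor_quadratic[of "-x"] False assms
    by (intro mult_left_mono) (auto simp: add_nonneg_nonneg)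
  finally show ?thesis by (simp add: exp_minus field_simps)
qed

section \<open>Edges as unordered pairs and counts of common neighbours\<close>

text \<open>The orientation used by \<open>node_pairs\<close>, so that both entries
  \<open>(i, j)\<close> and \<open>(j, i)\<close> of the adjacency matrix read the same
  coordinate.\<close>

definition edge :: "nat \<Rightarrow> nat \<Rightarrow> nat \<times> nat" where
  "edge i j = (min i j, max i j)"

lemma adjacency_edge: "i \<noteq> j \<Longrightarrow> adjacency e i j = of_bool (e (edge i j))"
  by (auto simp: adjacency_def edge_def min_def max_def)

lemma adjacency_self: "adjacency e i i = 0"
  by (simp add: adjacency_def)

lemma edge_in_node_pairs: "i \<in> {1..n} \<Longrightarrow> j \<in> {1..n} \<Longrightarrow> i \<noteq> j \<Longrightarrow> edge i j \<in> node_pairs n"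
  by (auto simp: edge_def node_pairs_def)

lemma edge_eq_iff: "edge i j = edge k l \<longleftrightarrow> (i = k \<and> j = l) \<or> (i = l \<and> j = k)"
  by (auto simp: edge_def min_def max_def split: if_splits)

lemma finite_node_pairs: "finite (node_pairs n)"
  by (rule finite_subset[of _ "{1..n} \<times> {1..n}"]) (auto simp: node_pairs_def)

text \<open>A family over all pairs, since \<open>product_prob_space\<close> asks for a probability
  measure at every index and not only on \<open>node_pairs\<close>.\<close>

definition edge_law :: "('a \<Rightarrow> 'a \<Rightarrow> real) \<Rightarrow> real \<Rightarrow> (nat \<Rightarrow> 'a) \<Rightarrow> nat \<times> nat \<Rightarrow> bool measure" where
  "edge_law W \<rho> \<omega> p = measure_pmf (bernoulli_pmf (\<rho> * W (\<omega> (fst p)) (\<omega> (snd p))))"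

lemma edge_measure_eq: "edge_measure n W \<rho> \<omega> = PiM (node_pairs n) (edge_law W \<rho> \<omega>)"
  unfolding edge_measure_def edge_law_def by (intro PiM_cong) auto

lemma product_prob_space_edge_law: "product_prob_space (edge_law W \<rho> \<omega>)"
  by (rule product_prob_spaceI) (simp add: edge_law_def measure_pmf.prob_space_axioms)

text \<open>The indices \<open>i\<close> and \<open>j\<close> are left out because a diagonal entry
  makes their terms vanish; the terms that remain depend on pairwise disjoint sets of edges.\<close>

definition common_nbrs :: "nat \<Rightarrow> (nat \<times> nat \<Rightarrow> bool) \<Rightarrow> nat \<Rightarrow> nat \<Rightarrow> real" where
  "common_nbrs n e i j = (\<Sum>k\<in>{1..n} - {i, j}. adjacency e i k * adjacency e j k)"

text \<open>A product of independent Bernoulli variables is Bernoulli with the product of the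
  parameters; this is its moment generating function at \<open>c\<close>.\<close>

lemma nn_integral_bernoulli_pair_exp:
  assumes "p \<in> {0..1}" "q \<in> {0..1}"
  shows "(\<integral>\<^sup>+v. \<integral>\<^sup>+u. ennreal (exp (c * (of_bool u * of_bool v)))
      \<partial>measure_pmf (bernoulli_pmf p) \<partial>measure_pmf (bernoulli_pmf q)) =
    ennreal (1 + (exp c - 1) * (p * q))"
proof -
  have "(\<integral>\<^sup>+v. \<integral>\<^sup>+u. ennreal (exp (c * (of_bool u * of_bool v)))
      \<partial>measure_pmf (bernoulli_pmf p) \<partial>measure_pmf (bernoulli_pmf q)) =
    ennreal ((exp c * p + (1 - p)) * q + (1 - q))"
    using assms
    by (simp add: ennreal_mult[symmetric] ennreal_plus[symmetric] del: ennreal_plus)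
  also have "(exp c * p + (1 - p)) * q + (1 - q) = 1 + (exp c - 1) * (p * q)"
    by (simp add: algebra_simps)
  finally show ?thesis .
qed

section \<open>Moment generating functions of the counts\<close>

context graphon
begin

abbreviation latent :: "nat \<Rightarrow> (nat \<Rightarrow> 'a) measure" where
  "latent n \<equiv> (\<Pi>\<^sub>M i\<in>{1..n}. M)"

text \<open>The L2 inner product of the rows \<open>W x\<close> and \<open>W y\<close>. Multiplied
  by \<open>\<rho>\<^sup>2\<close> it is the conditional mean of one term of
  \<open>common_nbrs\<close> given the positions of the two nodes.\<close>

definition overlap :: "'a \<Rightarrow> 'a \<Rightarrow> real" where
  "overlap x y = (\<integral>z. W x z * W y z \<partial>M)"

lemma W_comp_measurable [measurable (raw)]:
  assumes "f \<in> N \<rightarrow>\<^sub>M M" "g \<in> N \<rightarrow>\<^sub>M M"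
  shows "(\<lambda>x. W (f x) (g x)) \<in> borel_measurable N"
  using measurable_compose[OF measurable_Pair[OF assms] W_measurable] by simp

lemma W_bounds: "x \<in> space M \<Longrightarrow> y \<in> space M \<Longrightarrow> 0 \<le> W x y \<and> W x y \<le> 1"
  using W_range by auto

lemma latent_space: "\<omega> \<in> space (latent n) \<Longrightarrow> i \<in> {1..n} \<Longrightarrow> \<omega> i \<in> space M"
  by (auto simp: space_PiM PiE_def)

text \<open>Given all positions, the terms for different \<open>k\<close> live on disjoint pairs of
  edges, so \<open>nn_integral_prod_pairs\<close> turns the exponential of the sum into a product of
  Bernoulli moment generating functions.\<close>

lemma edge_mgf:
  assumes \<omega>: "\<omega> \<in> space (latent n)" and \<rho>: "0 \<le> \<rho>" "\<rho> \<le> 1"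
    and ij: "i \<in> {1..n}" "j \<in> {1..n}" "i \<noteq> j"
  shows "(\<integral>\<^sup>+e. ennreal (exp (c * common_nbrs n e i j)) \<partial>edge_measure n W \<rho> \<omega>) =
    (\<Prod>k\<in>{1..n} - {i, j}. ennreal (1 + (exp c - 1) * (\<rho>\<^sup>2 * (W (\<omega> i) (\<omega> k) * W (\<omega> j) (\<omega> k)))))"
proof -
  interpret E: product_prob_space "edge_law W \<rho> \<omega>"
    by (rule product_prob_space_edge_law)
  \<comment> \<open>Symmetry of \<open>W\<close> makes the law of an edge independent of the
    orientation chosen by \<open>edge\<close>.\<close>
  have p: "edge_law W \<rho> \<omega> (edge l k) = measure_pmf (bernoulli_pmf (\<rho> * W (\<omega> l) (\<omega> k)))"
    and q: "\<rho> * W (\<omega> l) (\<omega> k) \<in> {0..1}" if "l \<in> {1..n}" "k \<in> {1..n}" for l k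
    using W_sym[of "\<omega> l" "\<omega> k"] W_bounds[of "\<omega> l" "\<omega> k"] latent_space[OF \<omega>] that \<rho>
    by (auto simp: edge_law_def edge_def min_def max_def mult_le_one)
  have "(\<integral>\<^sup>+e. ennreal (exp (c * common_nbrs n e i j)) \<partial>edge_measure n W \<rho> \<omega>) =
    (\<integral>\<^sup>+e. (\<Prod>k\<in>{1..n} - {i, j}. ennreal (exp (c * (of_bool (e (edge i k)) * of_bool (e (edge j k))))))
      \<partial>PiM (node_pairs n) (edge_law W \<rho> \<omega>))"
    unfolding edge_measure_eq common_nbrs_def sum_distrib_left
    by (intro nn_integral_cong) (simp add: exp_sum prod_ennreal adjacency_edge)
  also have "\<dots> = (\<Prod>k\<in>{1..n} - {i, j}. \<integral>\<^sup>+v. \<integral>\<^sup>+u. ennreal (exp (c * (of_bool u * of_bool v)))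
      \<partial>edge_law W \<rho> \<omega> (edge i k) \<partial>edge_law W \<rho> \<omega> (edge j k))"
    using ij
    by (intro E.nn_integral_prod_pairs[where a = "edge i" and b = "edge j" and
          f = "\<lambda>_ u v. ennreal (exp (c * (of_bool u * of_bool v)))"] finite_node_pairs)
      (auto simp: edge_eq_iff disjoint_family_on_def edge_law_def intro!: edge_in_node_pairs)
  also have "\<dots> = (\<Prod>k\<in>{1..n} - {i, j}.
      ennreal (1 + (exp c - 1) * (\<rho>\<^sup>2 * (W (\<omega> i) (\<omega> k) * W (\<omega> j) (\<omega> k)))))"
  proof (rule prod.cong[OF refl])
    fix k assume k: "k \<in> {1..n} - {i, j}"
    then show "(\<integral>\<^sup>+v. \<integral>\<^sup>+u. ennreal (exp (c * (of_bool u * of_bool v)))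
        \<partial>edge_law W \<rho> \<omega> (edge i k) \<partial>edge_law W \<rho> \<omega> (edge j k)) =
      ennreal (1 + (exp c - 1) * (\<rho>\<^sup>2 * (W (\<omega> i) (\<omega> k) * W (\<omega> j) (\<omega> k))))"
      using ij p[of i k] p[of j k] nn_integral_bernoulli_pair_exp[OF q[of i k] q[of j k]]
      by (simp add: power2_eq_square mult.assoc mult.left_commute)
  qed
  finally show ?thesis .
qed

lemma W_mult_integrable:
  assumes "x \<in> space M" "y \<in> space M"
  shows "integrable M (\<lambda>z. W x z * W y z)"
  using assms W_bounds
  by (intro integrable_const_bound[where B = 1]) (auto intro!: AE_I2 mult_le_one)

lemma overlap_bounds:
  assumes "x \<in> space M" "y \<in> space M"
  shows "0 \<le> overlap x y" "overlap x y \<le> 1"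
proof -
  show "0 \<le> overlap x y"
    unfolding overlap_def using assms W_bounds by (intro integral_nonneg_AE AE_I2) auto
  have "overlap x y \<le> (\<integral>z. 1 \<partial>M)"
    unfolding overlap_def using assms W_bounds W_mult_integrable
    by (intro integral_mono_AE AE_I2) (auto intro!: mult_le_one)
  then show "overlap x y \<le> 1" by (simp add: prob_space)
qed

lemma overlap_measurable [measurable (raw)]:
  assumes [measurable]: "f \<in> N \<rightarrow>\<^sub>M M" "g \<in> N \<rightarrow>\<^sub>M M"
  shows "(\<lambda>x. overlap (f x) (g x)) \<in> borel_measurable N"
  unfolding overlap_def by measurable

text \<open>With the positions of \<open>i\<close> and \<open>j\<close> fixed, the other
  \<open>n - 2\<close> positions are independent, so each factor averages to
  \<open>1 + (exp c - 1) * p \<le> exp ((exp c - 1) * p)\<close> with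
  \<open>p = \<rho>\<^sup>2 * overlap x y\<close>. The centring leaves
  \<open>(n - 2) * p * (exp c - 1 - c)\<close> in the exponent, and this is bounded uniformly in the
  two fixed positions.\<close>

lemma latent_mgf:
  assumes c: "\<bar>c\<bar> \<le> 1" and \<rho>: "0 \<le> \<rho>" "\<rho> \<le> 1"
    and ij: "i \<in> {1..n}" "j \<in> {1..n}" "i \<noteq> j"
  shows "(\<integral>\<^sup>+\<omega>. ennreal (exp (- (c * ((real n - 2) * (\<rho>\<^sup>2 * overlap (\<omega> i) (\<omega> j)))))) *
      (\<Prod>k\<in>{1..n} - {i, j}. ennreal (1 + (exp c - 1) * (\<rho>\<^sup>2 * (W (\<omega> i) (\<omega> k) * W (\<omega> j) (\<omega> k)))))
      \<partial>latent n) \<le> ennreal (exp ((real n - 2) * \<rho>\<^sup>2 * c\<^sup>2))"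
proof -
  interpret L: product_prob_space "\<lambda>_::nat. M"
    by (rule product_prob_spaceI) (rule prob_space_axioms)
  define K where "K = {1..n} - {i, j}"
  have un: "{1..n} = {i, j} \<union> K" and fin: "finite K" and dis: "{i, j} \<inter> K = {}"
    using ij by (auto simp: K_def)
  have "card {1..n} = card {i, j} + card K"
    unfolding un by (rule card_Un_disjoint) (use fin dis in auto)
  then have card: "real (card K) = real n - 2" using ij by simp
  define F where "F = (\<lambda>x y. ennreal (exp (- (c * ((real n - 2) * (\<rho>\<^sup>2 * overlap x y))))))"
  define H where "H = (\<lambda>x y z. ennreal (1 + (exp c - 1) * (\<rho>\<^sup>2 * (W x z * W y z))))"
  have [measurable]: "(\<lambda>\<omega>. F (\<omega> i) (\<omega> j)) \<in> borel_measurable (Pi\<^sub>M S (\<lambda>_. M))"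
    if "i \<in> S" "j \<in> S" for S
    using that unfolding F_def by measurable
  have [measurable]: "(\<lambda>\<omega>. H (\<omega> i) (\<omega> j) (\<omega> k)) \<in> borel_measurable (Pi\<^sub>M S (\<lambda>_. M))"
    if "i \<in> S" "j \<in> S" "k \<in> S" for S k
    using that unfolding H_def by measurable
  have bound: "F x y * (\<Prod>k\<in>K. \<integral>\<^sup>+z. H x y z \<partial>M) \<le> ennreal (exp ((real n - 2) * \<rho>\<^sup>2 * c\<^sup>2))"
    if xy: "x \<in> space M" "y \<in> space M" for x y
  proof -
    define p where "p = \<rho>\<^sup>2 * overlap x y"
    have p: "0 \<le> p" "p \<le> \<rho>\<^sup>2"
      using overlap_bounds[OF xy] by (auto simp: p_def mult_left_le)
    have nonneg: "0 \<le> 1 + (exp c - 1) * (\<rho>\<^sup>2 * (W x z * W y z))" if "z \<in> space M" for z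
    proof -
      let ?q = "\<rho>\<^sup>2 * (W x z * W y z)"
      have "0 \<le> ?q" "?q \<le> 1"
        using W_bounds xy that \<rho> by (auto intro!: mult_le_one simp: power_le_one)
      then have "0 \<le> (1 - ?q) + exp c * ?q" by simp
      then show ?thesis by (simp add: algebra_simps)
    qed
    have int: "integrable M (\<lambda>z. 1 + (exp c - 1) * (\<rho>\<^sup>2 * (W x z * W y z)))"
      using W_mult_integrable[OF xy] by simp
    have "(\<integral>\<^sup>+z. H x y z \<partial>M) = ennreal (\<integral>z. 1 + (exp c - 1) * (\<rho>\<^sup>2 * (W x z * W y z)) \<partial>M)"
      unfolding H_def using nonneg int by (intro nn_integral_eq_integral AE_I2) auto
    also have "(\<integral>z. 1 + (exp c - 1) * (\<rho>\<^sup>2 * (W x z * W y z)) \<partial>M) = 1 + (exp c - 1) * p"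
      using W_mult_integrable[OF xy] by (simp add: p_def overlap_def prob_space)
    also have "ennreal (1 + (exp c - 1) * p) \<le> ennreal (exp ((exp c - 1) * p))"
      by (intro ennreal_leI exp_ge_add_one_self)
    finally have "F x y * (\<Prod>k\<in>K. \<integral>\<^sup>+z. H x y z \<partial>M) \<le>
        F x y * (\<Prod>k\<in>K. ennreal (exp ((exp c - 1) * p)))"
      unfolding prod_constant by (intro mult_left_mono power_mono) auto
    also have "\<dots> = ennreal (exp (- (c * ((real n - 2) * p)) + (real n - 2) * ((exp c - 1) * p)))"
      using card
      by (simp add: F_def p_def ennreal_mult[symmetric] ennreal_power exp_of_nat_mult[symmetric] mult_exp_exp)
    also have "\<dots> \<le> ennreal (exp ((real n - 2) * \<rho>\<^sup>2 * c\<^sup>2))"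
    proof -
      have N: "0 \<le> real n - 2" using card by simp
      \<comment> \<open>As \<open>exp c - 1 - c\<close> is nonnegative for either sign of
        \<open>c\<close>, \<open>p\<close> may be enlarged to \<open>\<rho>\<^sup>2\<close> in both
        tails.\<close>
      have "c \<le> exp c - 1" using exp_ge_add_one_self[of c] by linarith
      have "- (c * ((real n - 2) * p)) + (real n - 2) * ((exp c - 1) * p) =
          (real n - 2) * (p * (exp c - 1 - c))"
        by (simp add: algebra_simps)
      also have "\<dots> \<le> (real n - 2) * (\<rho>\<^sup>2 * c\<^sup>2)"
        using exp_le_quadratic[OF c] \<open>c \<le> exp c - 1\<close> p N
        by (intro mult_left_mono mult_mono) auto
      finally show ?thesis by (intro ennreal_leI) (simp add: mult.assoc)
    qed
    finally show ?thesis .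
  qed
  have "(\<integral>\<^sup>+\<omega>. F (\<omega> i) (\<omega> j) * (\<Prod>k\<in>K. H (\<omega> i) (\<omega> j) (\<omega> k)) \<partial>latent n) =
    (\<integral>\<^sup>+x. \<integral>\<^sup>+y. F (x i) (x j) * (\<Prod>k\<in>K. H (x i) (x j) (y k))
      \<partial>Pi\<^sub>M K (\<lambda>_. M) \<partial>Pi\<^sub>M {i, j} (\<lambda>_. M))"
    unfolding un using dis fin
    by (subst L.product_nn_integral_fold)
      (auto simp: merge_def intro!: nn_integral_cong prod.cong arg_cong2[where f = "(*)"])
  also have "\<dots> = (\<integral>\<^sup>+x. F (x i) (x j) * (\<Prod>k\<in>K. \<integral>\<^sup>+z. H (x i) (x j) z \<partial>M)
      \<partial>Pi\<^sub>M {i, j} (\<lambda>_. M))"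
  proof (rule nn_integral_cong)
    fix x assume x: "x \<in> space (Pi\<^sub>M {i, j} (\<lambda>_. M))"
    then have [measurable]: "x i \<in> space M" "x j \<in> space M" by (auto simp: space_PiM)
    have [measurable]: "H (x i) (x j) \<in> borel_measurable M" unfolding H_def by measurable
    have "(\<integral>\<^sup>+y. F (x i) (x j) * (\<Prod>k\<in>K. H (x i) (x j) (y k)) \<partial>Pi\<^sub>M K (\<lambda>_. M)) =
      F (x i) (x j) * (\<integral>\<^sup>+y. (\<Prod>k\<in>K. H (x i) (x j) (y k)) \<partial>Pi\<^sub>M K (\<lambda>_. M))"
      by (intro nn_integral_cmult) measurable
    also have "(\<integral>\<^sup>+y. (\<Prod>k\<in>K. H (x i) (x j) (y k)) \<partial>Pi\<^sub>M K (\<lambda>_. M)) =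
      (\<Prod>k\<in>K. \<integral>\<^sup>+z. H (x i) (x j) z \<partial>M)"
      using fin by (intro L.product_nn_integral_prod) auto
    finally show "(\<integral>\<^sup>+y. F (x i) (x j) * (\<Prod>k\<in>K. H (x i) (x j) (y k)) \<partial>Pi\<^sub>M K (\<lambda>_. M)) =
      F (x i) (x j) * (\<Prod>k\<in>K. \<integral>\<^sup>+z. H (x i) (x j) z \<partial>M)" .
  qed
  also have "\<dots> \<le> (\<integral>\<^sup>+x. ennreal (exp ((real n - 2) * \<rho>\<^sup>2 * c\<^sup>2)) \<partial>Pi\<^sub>M {i, j} (\<lambda>_. M))"
    by (intro nn_integral_mono bound) (auto simp: space_PiM)
  also have "\<dots> = ennreal (exp ((real n - 2) * \<rho>\<^sup>2 * c\<^sup>2))"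
  proof -
    interpret PI: prob_space "Pi\<^sub>M {i, j} (\<lambda>_. M)" by (intro prob_space_PiM prob_space_axioms)
    show ?thesis by (simp add: PI.emeasure_space_1)
  qed
  finally show ?thesis unfolding F_def H_def K_def .
qed

end

section \<open>The joint law of positions and edges\<close>

abbreviation edge_space :: "nat \<Rightarrow> (nat \<times> nat \<Rightarrow> bool) measure" where
  "edge_space n \<equiv> (\<Pi>\<^sub>M p\<in>node_pairs n. count_space UNIV)"

text \<open>Finitely many pairs with two values each give a discrete space: every function of the
  edges is measurable, and events split into single configurations.\<close>

lemma edge_space_eq: "edge_space n = count_space (node_pairs n \<rightarrow>\<^sub>E UNIV)"
  by (rule count_space_PiM_finite) (auto simp: finite_node_pairs)

lemma edge_space_measurable: "f \<in> borel_measurable (edge_space n)"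
  unfolding edge_space_eq by simp

lemma sets_edge_measure: "sets (edge_measure n W \<rho> \<omega>) = sets (edge_space n)"
  unfolding edge_measure_eq by (intro sets_PiM_cong) (auto simp: edge_law_def)

lemma prob_space_edge_measure: "prob_space (edge_measure n W \<rho> \<omega>)"
  unfolding edge_measure_eq
  by (intro prob_space_PiM) (simp add: edge_law_def measure_pmf.prob_space_axioms)

context graphon
begin

text \<open>The probability of a set of configurations is a finite sum of finite products of edge
  probabilities, hence measurable in the positions. This gives access to the rules for
  \<open>bind\<close>.\<close>

lemma edge_measure_kernel:
  assumes \<rho>: "0 \<le> \<rho>" "\<rho> \<le> 1"
  shows "edge_measure n W \<rho> \<in> latent n \<rightarrow>\<^sub>M subprob_algebra (edge_space n)"
proof (rule measurable_subprob_algebra)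
  fix A assume "A \<in> sets (edge_space n)"
  then have A: "A \<subseteq> node_pairs n \<rightarrow>\<^sub>E UNIV" unfolding edge_space_eq by simp
  then have fin: "finite A"
    by (rule finite_subset) (auto intro: finite_PiE finite_node_pairs)
  have "emeasure (edge_measure n W \<rho> \<omega>) A = (\<Sum>e\<in>A. \<Prod>(k, l)\<in>node_pairs n.
      ennreal (if e (k, l) then \<rho> * W (\<omega> k) (\<omega> l) else 1 - \<rho> * W (\<omega> k) (\<omega> l)))"
    if \<omega>: "\<omega> \<in> space (latent n)" for \<omega>
  proof -
    interpret E: product_prob_space "edge_law W \<rho> \<omega>"
      by (rule product_prob_space_edge_law)
    have sing: "{e} = (\<Pi>\<^sub>E p\<in>node_pairs n. {e p})" if "e \<in> A" for e
      using A that by (subst PiE_singleton) (auto simp: PiE_def)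
    have "emeasure (edge_measure n W \<rho> \<omega>) A = (\<Sum>e\<in>A. emeasure (edge_measure n W \<rho> \<omega>) {e})"
      using A by (intro emeasure_eq_sum_singleton fin) (auto simp: sets_edge_measure edge_space_eq)
    also have "\<dots> = (\<Sum>e\<in>A. \<Prod>p\<in>node_pairs n. emeasure (edge_law W \<rho> \<omega> p) {e p})"
    proof (rule sum.cong[OF refl])
      fix e assume "e \<in> A"
      show "emeasure (edge_measure n W \<rho> \<omega>) {e} =
          (\<Prod>p\<in>node_pairs n. emeasure (edge_law W \<rho> \<omega> p) {e p})"
        unfolding edge_measure_eq sing[OF \<open>e \<in> A\<close>]
        by (intro E.emeasure_PiM finite_node_pairs) (auto simp: edge_law_def)
    qed
    also have "\<dots> = (\<Sum>e\<in>A. \<Prod>(k, l)\<in>node_pairs n.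
      ennreal (if e (k, l) then \<rho> * W (\<omega> k) (\<omega> l) else 1 - \<rho> * W (\<omega> k) (\<omega> l)))"
    proof (intro sum.cong prod.cong refl, clarsimp)
      fix e k l assume "e \<in> A" and kl: "(k, l) \<in> node_pairs n"
      then have "0 \<le> \<rho> * W (\<omega> k) (\<omega> l)" "\<rho> * W (\<omega> k) (\<omega> l) \<le> 1"
        using W_bounds[of "\<omega> k" "\<omega> l"] latent_space[OF \<omega>] \<rho>
        by (auto simp: node_pairs_def intro!: mult_le_one)
      then show "(e (k, l) \<longrightarrow> emeasure (edge_law W \<rho> \<omega> (k, l)) {True} = ennreal (\<rho> * W (\<omega> k) (\<omega> l))) \<and>
          (\<not> e (k, l) \<longrightarrow> emeasure (edge_law W \<rho> \<omega> (k, l)) {False} = ennreal (1 - \<rho> * W (\<omega> k) (\<omega> l)))"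
        by (simp add: edge_law_def emeasure_pmf_single)
    qed
    finally show ?thesis .
  qed
  moreover have "(\<lambda>\<omega>. \<Sum>e\<in>A. \<Prod>(k, l)\<in>node_pairs n.
      ennreal (if e (k, l) then \<rho> * W (\<omega> k) (\<omega> l) else 1 - \<rho> * W (\<omega> k) (\<omega> l)))
      \<in> borel_measurable (latent n)"
  proof (intro borel_measurable_sum borel_measurable_prod_ennreal)
    fix e p assume "p \<in> node_pairs n"
    then have [measurable]: "fst p \<in> {1..n}" "snd p \<in> {1..n}" by (auto simp: node_pairs_def)
    show "(\<lambda>\<omega>. case p of (k, l) \<Rightarrow>
        ennreal (if e (k, l) then \<rho> * W (\<omega> k) (\<omega> l) else 1 - \<rho> * W (\<omega> k) (\<omega> l)))
      \<in> borel_measurable (latent n)"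
      unfolding split_beta by measurable
  qed
  ultimately show "(\<lambda>\<omega>. emeasure (edge_measure n W \<rho> \<omega>) A) \<in> borel_measurable (latent n)"
    by (subst measurable_cong) auto
qed (simp_all add: sets_edge_measure prob_space_edge_measure prob_space_imp_subprob_space)

lemma latent_nonempty: "space (latent n) \<noteq> {}"
  by (simp add: prob_space.not_empty prob_space_PiM prob_space_axioms)

lemma sparse_kernel:
  assumes "0 \<le> \<rho>" "\<rho> \<le> 1"
  shows "(\<lambda>\<omega>. distr (edge_measure n W \<rho> \<omega>) (latent n \<Otimes>\<^sub>M edge_space n) (Pair \<omega>))
    \<in> latent n \<rightarrow>\<^sub>M subprob_algebra (latent n \<Otimes>\<^sub>M edge_space n)"
  by (rule measurable_distr2[OF _ edge_measure_kernel[OF assms]]) simp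

lemma sets_sparse: "sets (sparse_graphon_measure n M W \<rho>) = sets (latent n \<Otimes>\<^sub>M edge_space n)"
  unfolding sparse_graphon_measure_def using latent_nonempty by (subst sets_bind) auto

lemma space_sparse: "space (sparse_graphon_measure n M W \<rho>) = space (latent n) \<times> space (edge_space n)"
  using sets_eq_imp_space_eq[OF sets_sparse] by (simp add: space_pair_measure)

lemma Pair_edge_measurable:
  assumes "\<omega> \<in> space (latent n)"
  shows "Pair \<omega> \<in> edge_measure n W \<rho> \<omega> \<rightarrow>\<^sub>M latent n \<Otimes>\<^sub>M edge_space n"
  using measurable_Pair1'[OF assms] measurable_cong_sets[OF sets_edge_measure refl] by blast

lemma prob_space_sparse:
  assumes "0 \<le> \<rho>" "\<rho> \<le> 1"
  shows "prob_space (sparse_graphon_measure n M W \<rho>)"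
proof -
  interpret L: prob_space "latent n" by (intro prob_space_PiM prob_space_axioms)
  show ?thesis
    unfolding sparse_graphon_measure_def
    by (intro L.prob_space_bind[OF _ sparse_kernel[OF assms]] AE_I2 prob_space.prob_space_distr
        prob_space_edge_measure Pair_edge_measurable)
qed

text \<open>The disintegration by which the edges are integrated out first and the positions
  afterwards.\<close>

lemma nn_integral_sparse:
  assumes "0 \<le> \<rho>" "\<rho> \<le> 1" and f: "f \<in> borel_measurable (latent n \<Otimes>\<^sub>M edge_space n)"
  shows "(\<integral>\<^sup>+x. f x \<partial>sparse_graphon_measure n M W \<rho>) =
    (\<integral>\<^sup>+\<omega>. \<integral>\<^sup>+e. f (\<omega>, e) \<partial>edge_measure n W \<rho> \<omega> \<partial>latent n)"
  unfolding sparse_graphon_measure_def nn_integral_bind[OF f sparse_kernel[OF assms(1,2)]]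
  by (intro nn_integral_cong nn_integral_distr Pair_edge_measurable)
    (simp_all only: measurable_distr_eq1 f)

section \<open>Chernoff bound for the counts\<close>

lemma common_nbrs_measurable [measurable]:
  "(\<lambda>x. common_nbrs n (snd x) i j) \<in> borel_measurable (latent n \<Otimes>\<^sub>M edge_space n)"
  using measurable_compose[OF measurable_snd edge_space_measurable[of "\<lambda>e. common_nbrs n e i j"]] .

text \<open>Exponential Markov inequality: the indicator of \<open>s \<le> Z\<close> is at most
  \<open>exp (Z - s)\<close>, whose integral is evaluated over the edges by \<open>edge_mgf\<close>
  and then bounded over the positions by \<open>latent_mgf\<close>. The sign of \<open>c\<close>
  selects the upper or the lower tail.\<close>

lemma common_nbrs_chernoff:
  assumes c: "\<bar>c\<bar> \<le> 1" and \<rho>: "0 \<le> \<rho>" "\<rho> \<le> 1"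
    and ij: "i \<in> {1..n}" "j \<in> {1..n}" "i \<noteq> j"
  shows "emeasure (sparse_graphon_measure n M W \<rho>)
      {(\<omega>, e) \<in> space (sparse_graphon_measure n M W \<rho>).
        s \<le> c * (common_nbrs n e i j - (real n - 2) * (\<rho>\<^sup>2 * overlap (\<omega> i) (\<omega> j)))}
    \<le> ennreal (exp ((real n - 2) * \<rho>\<^sup>2 * c\<^sup>2 - s))"
proof -
  let ?D = "sparse_graphon_measure n M W \<rho>"
  define Z where "Z = (\<lambda>x. c * (common_nbrs n (snd x) i j -
    (real n - 2) * (\<rho>\<^sup>2 * overlap (fst x i) (fst x j))))"
  note [measurable] = ij(1,2)
  have Z[measurable]: "Z \<in> borel_measurable (latent n \<Otimes>\<^sub>M edge_space n)"
    unfolding Z_def by measurable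
  then have [measurable]: "Z \<in> borel_measurable ?D"
    using measurable_cong_sets[OF sets_sparse refl] by blast
  define F where "F = (\<lambda>\<omega>. ennreal (exp (- (c * ((real n - 2) * (\<rho>\<^sup>2 * overlap (\<omega> i) (\<omega> j)))))))"
  define P where "P = (\<lambda>\<omega>. \<Prod>k\<in>{1..n} - {i, j}.
    ennreal (1 + (exp c - 1) * (\<rho>\<^sup>2 * (W (\<omega> i) (\<omega> k) * W (\<omega> j) (\<omega> k)))))"
  have [measurable]: "F \<in> borel_measurable (latent n)" unfolding F_def by measurable
  have [measurable]: "P \<in> borel_measurable (latent n)"
    unfolding P_def by (intro borel_measurable_prod_ennreal) measurable
  have eq: "{(\<omega>, e) \<in> space ?D.
      s \<le> c * (common_nbrs n e i j - (real n - 2) * (\<rho>\<^sup>2 * overlap (\<omega> i) (\<omega> j)))} =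
    {x \<in> space ?D. s \<le> Z x}"
    by (auto simp: Z_def)
  have "emeasure ?D {x \<in> space ?D. s \<le> Z x} = (\<integral>\<^sup>+x. indicator {x \<in> space ?D. s \<le> Z x} x \<partial>?D)"
    by (intro nn_integral_indicator[symmetric]) measurable
  also have "\<dots> \<le> (\<integral>\<^sup>+x. ennreal (exp (Z x - s)) \<partial>?D)"
    by (intro nn_integral_mono) (auto simp: indicator_def)
  also have "\<dots> = (\<integral>\<^sup>+\<omega>. \<integral>\<^sup>+e. ennreal (exp (Z (\<omega>, e) - s)) \<partial>edge_measure n W \<rho> \<omega> \<partial>latent n)"
    by (intro nn_integral_sparse \<rho>) measurable
  also have "\<dots> = (\<integral>\<^sup>+\<omega>. ennreal (exp (- s)) * (F \<omega> * P \<omega>) \<partial>latent n)"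
  proof (rule nn_integral_cong)
    fix \<omega> assume \<omega>: "\<omega> \<in> space (latent n)"
    have [measurable]: "(\<lambda>e. common_nbrs n e i j) \<in> borel_measurable (edge_measure n W \<rho> \<omega>)"
      using edge_space_measurable measurable_cong_sets[OF sets_edge_measure refl] by blast
    have "(\<integral>\<^sup>+e. ennreal (exp (Z (\<omega>, e) - s)) \<partial>edge_measure n W \<rho> \<omega>) =
      (\<integral>\<^sup>+e. (ennreal (exp (- s)) * F \<omega>) * ennreal (exp (c * common_nbrs n e i j)) \<partial>edge_measure n W \<rho> \<omega>)"
      by (intro nn_integral_cong)
        (simp add: Z_def F_def ennreal_mult[symmetric] mult_exp_exp algebra_simps)
    also have "\<dots> = (ennreal (exp (- s)) * F \<omega>) * P \<omega>"
      unfolding P_def edge_mgf[OF \<omega> \<rho> ij, symmetric] by (intro nn_integral_cmult) measurable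
    finally show "(\<integral>\<^sup>+e. ennreal (exp (Z (\<omega>, e) - s)) \<partial>edge_measure n W \<rho> \<omega>) =
        ennreal (exp (- s)) * (F \<omega> * P \<omega>)"
      by (simp add: mult.assoc)
  qed
  also have "\<dots> = ennreal (exp (- s)) * (\<integral>\<^sup>+\<omega>. F \<omega> * P \<omega> \<partial>latent n)"
    by (intro nn_integral_cmult) measurable
  also have "\<dots> \<le> ennreal (exp (- s)) * ennreal (exp ((real n - 2) * \<rho>\<^sup>2 * c\<^sup>2))"
    unfolding F_def P_def by (intro mult_left_mono latent_mgf c \<rho> ij) simp
  also have "\<dots> = ennreal (exp ((real n - 2) * \<rho>\<^sup>2 * c\<^sup>2 - s))"
    by (simp add: ennreal_mult[symmetric] mult_exp_exp)
  finally show ?thesis unfolding eq .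
qed

end

section \<open>Cauchy-Schwarz for square-integrable functions\<close>

text \<open>The discriminant argument: at \<open>(s, t) = (c, b)\<close> the form equals
  \<open>c * (a * c - b\<^sup>2)\<close>, which settles the case \<open>c > 0\<close>.\<close>

lemma quadratic_form_nonneg_imp:
  fixes a b c :: real
  assumes "\<And>s t. 0 \<le> s\<^sup>2 * a - 2 * s * t * b + t\<^sup>2 * c"
  shows "b\<^sup>2 \<le> a * c"
proof (cases "c = 0")
  case True
  have "0 \<le> a" using assms[of 1 0] by simp
  \<comment> \<open>With \<open>c = 0\<close> the form is linear in \<open>t\<close>;
    \<open>t = a + 1\<close> is large enough for the mixed term to outweigh
    \<open>b\<^sup>2 * a\<close>, which forces \<open>b = 0\<close>.\<close>
  have "0 \<le> b\<^sup>2 * a - 2 * b * (a + 1) * b"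
    using assms[of b "a + 1"] True by simp
  then have "0 \<le> - (b\<^sup>2 * (a + 2))" by (simp add: algebra_simps power2_eq_square)
  then have "b\<^sup>2 * (a + 2) \<le> 0" by simp
  with \<open>0 \<le> a\<close> have "b = 0" by (simp add: mult_le_0_iff)
  then show ?thesis using True by simp
next
  case False
  then have "0 < c" using assms[of 0 1] by simp
  have "0 \<le> c * (a * c - b\<^sup>2)"
    using assms[of c b] by (simp add: algebra_simps power2_eq_square)
  then show ?thesis using \<open>0 < c\<close> by (simp add: zero_le_mult_iff)
qed

text \<open>The nonnegative quadratic form is the integral of the square of
  \<open>s * f - t * g\<close>.\<close>

lemma Cauchy_Schwarz_integral:
  fixes f g :: "'a \<Rightarrow> real"
  assumes [simp]: "integrable M (\<lambda>x. (f x)\<^sup>2)" "integrable M (\<lambda>x. (g x)\<^sup>2)"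
    "integrable M (\<lambda>x. f x * g x)"
  shows "\<bar>\<integral>x. f x * g x \<partial>M\<bar> \<le> sqrt (\<integral>x. (f x)\<^sup>2 \<partial>M) * sqrt (\<integral>x. (g x)\<^sup>2 \<partial>M)"
proof -
  have "(\<integral>x. f x * g x \<partial>M)\<^sup>2 \<le> (\<integral>x. (f x)\<^sup>2 \<partial>M) * (\<integral>x. (g x)\<^sup>2 \<partial>M)"
  proof (rule quadratic_form_nonneg_imp)
    fix s t
    have "0 \<le> (\<integral>x. (s * f x - t * g x)\<^sup>2 \<partial>M)" by simp
    also have "\<dots> = (\<integral>x. s\<^sup>2 * (f x)\<^sup>2 - 2 * s * t * (f x * g x) + t\<^sup>2 * (g x)\<^sup>2 \<partial>M)"
      by (intro Bochner_Integration.integral_cong) (auto simp: power2_eq_square algebra_simps)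
    also have "\<dots> = s\<^sup>2 * (\<integral>x. (f x)\<^sup>2 \<partial>M) - 2 * s * t * (\<integral>x. f x * g x \<partial>M) + t\<^sup>2 * (\<integral>x. (g x)\<^sup>2 \<partial>M)"
      by simp
    finally show "0 \<le> s\<^sup>2 * (\<integral>x. (f x)\<^sup>2 \<partial>M) - 2 * s * t * (\<integral>x. f x * g x \<partial>M) + t\<^sup>2 * (\<integral>x. (g x)\<^sup>2 \<partial>M)" .
  qed
  then show ?thesis
    by (metis real_sqrt_abs real_sqrt_le_iff real_sqrt_mult)
qed

section \<open>Deterministic error bounds from off-diagonal concentration\<close>

lemma inner_n_diff_right: "inner_n n u (\<lambda>l. v l - w l) = inner_n n u v - inner_n n u w"
  by (simp add: inner_n_def sum_subtractf right_diff_distrib)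

lemma inner_n_adjacency:
  assumes "i \<in> {1..n}" "j \<in> {1..n}"
  shows "inner_n n (adjacency e i) (adjacency e j) = common_nbrs n e i j / real n"
proof -
  have "(\<Sum>k=1..n. adjacency e i k * adjacency e j k) = common_nbrs n e i j"
    unfolding common_nbrs_def
    by (intro sum.mono_neutral_right) (auto simp: adjacency_self)
  then show ?thesis by (simp add: inner_n_def)
qed

lemma f_hat_ge:
  assumes "k \<in> {1..n} - {i, j}"
  shows "\<bar>inner_n n (A k) (\<lambda>l. A i l - A j l)\<bar> \<le> f_hat n A i j"
  unfolding f_hat_def using assms by (intro Max_ge) auto

lemma f_hat_le:
  assumes "n \<ge> 3"
    and "\<And>k. k \<in> {1..n} - {i, j} \<Longrightarrow> \<bar>inner_n n (A k) (\<lambda>l. A i l - A j l)\<bar> \<le> B"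
  shows "f_hat n A i j \<le> B"
proof -
  have "card ({1..n} - {i, j}) \<ge> card {1..n} - card {i, j}"
    by (intro diff_card_le_card_Diff) simp
  moreover have "card {i, j} \<le> 2" by (simp add: card_insert_if)
  ultimately have "card ({1..n} - {i, j}) > 0" using assms(1) by simp
  then have "{1..n} - {i, j} \<noteq> {}" by (metis card.empty less_irrefl)
  then show ?thesis
    unfolding f_hat_def using assms(2) by (subst Max_le_iff) auto
qed

context graphon
begin

lemma overlap_commute: "overlap x y = overlap y x"
  by (simp add: overlap_def mult.commute)

lemma integral_W_diff_mult:
  assumes "x \<in> space M" "y \<in> space M" "u \<in> space M" "v \<in> space M"
  shows "(\<integral>z. (W x z - W y z) * (W u z - W v z) \<partial>M) =
      overlap x u - overlap x v - overlap y u + overlap y v"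
    and "integrable M (\<lambda>z. (W x z - W y z) * (W u z - W v z))"
  using assms W_mult_integrable by (simp_all add: overlap_def left_diff_distrib right_diff_distrib)

lemma nbhd_dist_eq: "nbhd_dist M W x y = sqrt (\<integral>z. (W x z - W y z)\<^sup>2 \<partial>M)"
  by (simp add: nbhd_dist_def)

lemma nbhd_dist_nonneg: "0 \<le> nbhd_dist M W x y"
  by (simp add: nbhd_dist_eq)

lemma nbhd_dist_sq:
  assumes "x \<in> space M" "y \<in> space M"
  shows "(nbhd_dist M W x y)\<^sup>2 = overlap x x + overlap y y - 2 * overlap x y"
proof -
  have "(nbhd_dist M W x y)\<^sup>2 = (\<integral>z. (W x z - W y z) * (W x z - W y z) \<partial>M)"
    by (simp add: nbhd_dist_eq power2_eq_square)
  also have "\<dots> = overlap x x + overlap y y - 2 * overlap x y"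
    using integral_W_diff_mult(1)[of x y x y] assms overlap_commute[of x y] by simp
  finally show ?thesis .
qed

lemma nbhd_dist_le_1:
  assumes "x \<in> space M" "y \<in> space M"
  shows "nbhd_dist M W x y \<le> 1"
proof -
  have "(\<integral>z. (W x z - W y z)\<^sup>2 \<partial>M) \<le> (\<integral>z. 1 \<partial>M)"
  proof (intro integral_mono_AE AE_I2)
    show "integrable M (\<lambda>z. (W x z - W y z)\<^sup>2)"
      using integral_W_diff_mult(2)[of x y x y] assms by (simp add: power2_eq_square)
    show "(W x z - W y z)\<^sup>2 \<le> 1" if "z \<in> space M" for z
      using W_bounds[of x z] W_bounds[of y z] assms that
      by (simp add: abs_square_le_1 abs_le_iff)
  qed simp
  then show ?thesis by (simp add: nbhd_dist_eq prob_space)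
qed

text \<open>Cauchy-Schwarz, as the left side is the inner product of \<open>W x - W y\<close> with
  \<open>W u - W v\<close>.\<close>

lemma overlap_diff_diff_le:
  assumes "x \<in> space M" "y \<in> space M" "u \<in> space M" "v \<in> space M"
  shows "\<bar>overlap x u - overlap x v - overlap y u + overlap y v\<bar> \<le> nbhd_dist M W x y * nbhd_dist M W u v"
  using Cauchy_Schwarz_integral[of M "\<lambda>z. W x z - W y z" "\<lambda>z. W u z - W v z"]
    integral_W_diff_mult[of x y x y] integral_W_diff_mult[of u v u v] integral_W_diff_mult[of x y u v] assms
  by (simp add: nbhd_dist_eq power2_eq_square)

text \<open>Cauchy-Schwarz against \<open>W u\<close>, whose L2 norm is at most 1.\<close>

lemma overlap_diff_le:
  assumes "x \<in> space M" "y \<in> space M" "u \<in> space M"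
  shows "\<bar>overlap u x - overlap u y\<bar> \<le> nbhd_dist M W x y"
proof -
  have "\<bar>\<integral>z. (W x z - W y z) * W u z \<partial>M\<bar> \<le> nbhd_dist M W x y * sqrt (overlap u u)"
    using Cauchy_Schwarz_integral[of M "\<lambda>z. W x z - W y z" "\<lambda>z. W u z"]
      integral_W_diff_mult[of x y x y] W_mult_integrable[of u u] W_mult_integrable[of x u]
      W_mult_integrable[of y u] assms
    by (simp add: nbhd_dist_eq power2_eq_square overlap_def left_diff_distrib)
  also have "\<dots> \<le> nbhd_dist M W x y"
    using overlap_bounds[of u u] assms nbhd_dist_nonneg by (simp add: mult_left_le)
  also have "(\<integral>z. (W x z - W y z) * W u z \<partial>M) = overlap u x - overlap u y"
    using assms W_mult_integrable
    by (simp add: overlap_def left_diff_distrib mult.commute[of "W u _"])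
  finally show ?thesis .
qed

text \<open>An oracle inequality: the selected \<open>h\<close> is compared with any other node
  \<open>m\<close> in place of the unknown nearest one, which \<open>r_hat_sq_error\<close> then
  inserts.\<close>

lemma selection_error:
  assumes n: "n \<ge> 3" and \<omega>: "\<omega> \<in> space (latent n)"
    and conc: "\<And>k l. k \<in> {1..n} \<Longrightarrow> l \<in> {1..n} \<Longrightarrow> k \<noteq> l \<Longrightarrow>
      \<bar>inner_n n (A k) (A l) - \<rho>\<^sup>2 * overlap (\<omega> k) (\<omega> l)\<bar> \<le> \<epsilon>"
    and i: "i \<in> {1..n}" and m: "m \<in> {1..n} - {i}"
    and h: "is_arg_min (f_hat n A i) (\<lambda>j. j \<in> {1..n} - {i}) h"
  shows "\<bar>inner_n n (A i) (A h) - \<rho>\<^sup>2 * overlap (\<omega> i) (\<omega> i)\<bar>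
    \<le> 2 * \<rho>\<^sup>2 * nbhd_dist M W (\<omega> i) (\<omega> m) + 5 * \<epsilon>"
proof -
  define q where "q = (\<lambda>k l. \<rho>\<^sup>2 * overlap (\<omega> k) (\<omega> l))"
  define r where "r = \<rho>\<^sup>2 * nbhd_dist M W (\<omega> i) (\<omega> m)"
  have sp: "\<omega> k \<in> space M" if "k \<in> {1..n}" for k using latent_space[OF \<omega> that] .
  have conc': "\<bar>inner_n n (A k) (A l) - q k l\<bar> \<le> \<epsilon>" if "k \<in> {1..n}" "l \<in> {1..n}" "k \<noteq> l" for k l
    using conc[OF that] by (simp add: q_def)
  have h1: "h \<in> {1..n}" "h \<noteq> i" and hmin: "f_hat n A i h \<le> f_hat n A i m"
    using h m by (auto simp: is_arg_min_def not_less)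
  have r0: "0 \<le> r" by (simp add: r_def nbhd_dist_nonneg)
  have lip: "\<bar>q k i - q k m\<bar> \<le> r" if "k \<in> {1..n}" for k
  proof -
    have "\<bar>q k i - q k m\<bar> = \<rho>\<^sup>2 * \<bar>overlap (\<omega> k) (\<omega> i) - overlap (\<omega> k) (\<omega> m)\<bar>"
      by (simp add: q_def abs_mult flip: right_diff_distrib)
    also have "\<dots> \<le> r"
      unfolding r_def using overlap_diff_le[OF sp sp sp] i m that by (intro mult_left_mono) auto
    finally show ?thesis .
  qed
  have \<epsilon>: "0 \<le> \<epsilon>" using conc'[of i m] i m by auto
  show ?thesis
  proof (cases "h = m")
    \<comment> \<open>Here row \<open>m\<close> is excluded from the maximum defining
      \<open>f_hat n A i h\<close> and cannot serve as a test, but \<open>lip\<close> at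
      \<open>k = i\<close> bounds the error directly.\<close>
    case True
    have "\<bar>inner_n n (A i) (A h) - q i i\<bar> \<le> \<epsilon> + r"
      using conc'[of i m] lip[of i] i m True by auto
    then show ?thesis using r0 \<epsilon> by (simp add: q_def r_def)
  next
    case False
    have "f_hat n A i m \<le> 2 * \<epsilon> + r"
    proof (rule f_hat_le[OF n])
      fix k assume "k \<in> {1..n} - {i, m}"
      then show "\<bar>inner_n n (A k) (\<lambda>l. A i l - A m l)\<bar> \<le> 2 * \<epsilon> + r"
        using conc'[of k i] conc'[of k m] lip[of k] i m by (auto simp: inner_n_diff_right)
    qed
    moreover have "\<bar>inner_n n (A m) (A i) - inner_n n (A m) (A h)\<bar> \<le> f_hat n A i h"
      using f_hat_ge[of m n i h A] m False by (simp add: inner_n_diff_right)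
    \<comment> \<open>\<open>2 * \<epsilon> + r\<close> comes from minimality of \<open>h\<close>,
      and another \<open>2 * \<epsilon>\<close> from replacing the two empirical products by
      \<open>q\<close>.\<close>
    ultimately have mih: "\<bar>q m i - q m h\<bar> \<le> 4 * \<epsilon> + r"
      using hmin conc'[of m i] conc'[of m h] i m h1 False by auto
    have "\<bar>q i i - q i h - q m i + q m h\<bar> =
        \<rho>\<^sup>2 * \<bar>overlap (\<omega> i) (\<omega> i) - overlap (\<omega> i) (\<omega> h) - overlap (\<omega> m) (\<omega> i) + overlap (\<omega> m) (\<omega> h)\<bar>"
      by (simp add: q_def abs_mult flip: right_diff_distrib distrib_left)
    also have "\<dots> \<le> \<rho>\<^sup>2 * (nbhd_dist M W (\<omega> i) (\<omega> m) * nbhd_dist M W (\<omega> i) (\<omega> h))"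
      using i m h1 by (intro mult_left_mono overlap_diff_diff_le sp) auto
    \<comment> \<open>The distance from \<open>i\<close> to \<open>h\<close> is not controlled, but
      the trivial bound 1 suffices because the other factor is the distance from \<open>i\<close> to
      \<open>m\<close>.\<close>
    also have "\<dots> \<le> r"
      unfolding r_def using i h1 nbhd_dist_le_1[OF sp sp, of i h] nbhd_dist_nonneg
      by (intro mult_left_mono mult_left_le) auto
    finally have "\<bar>q i i - q i h - q m i + q m h\<bar> \<le> r" .
    then have "\<bar>inner_n n (A i) (A h) - q i i\<bar> \<le> 2 * r + 5 * \<epsilon>"
      using mih conc'[of i h] i h1 by auto
    then show ?thesis by (simp add: q_def r_def)
  qed
qed

text \<open>The squared distance expands into two diagonal terms minus twice a mixed one. Each
  diagonal term costs \<open>5 * \<epsilon>\<close> by \<open>selection_error\<close> and the mixed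
  one \<open>2 * \<epsilon>\<close>, in total \<open>12 * \<epsilon>\<close>.\<close>

lemma r_hat_sq_error:
  assumes n: "n \<ge> 3" and \<omega>: "\<omega> \<in> space (latent n)"
    and conc: "\<And>k l. k \<in> {1..n} \<Longrightarrow> l \<in> {1..n} \<Longrightarrow> k \<noteq> l \<Longrightarrow>
      \<bar>inner_n n (A k) (A l) - \<rho>\<^sup>2 * overlap (\<omega> k) (\<omega> l)\<bar> \<le> \<epsilon>"
    and m: "nearest_selection n M W \<omega> m" and mh: "m_hat_selection n A mh"
    and ij: "i \<in> {1..n}" "j \<in> {1..n}" "i \<noteq> j"
  shows "\<bar>\<rho>\<^sup>2 * (nbhd_dist M W (\<omega> i) (\<omega> j))\<^sup>2 - r_hat_sq n A mh i j\<bar>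
    \<le> 2 * \<rho>\<^sup>2 * (nbhd_dist M W (\<omega> j) (\<omega> (m j)) + nbhd_dist M W (\<omega> i) (\<omega> (m i))) + 12 * \<epsilon>"
proof -
  have sel: "\<bar>inner_n n (A k) (A (mh k)) - \<rho>\<^sup>2 * overlap (\<omega> k) (\<omega> k)\<bar>
      \<le> 2 * \<rho>\<^sup>2 * nbhd_dist M W (\<omega> k) (\<omega> (m k)) + 5 * \<epsilon>" if "k \<in> {1..n}" for k
    using that m mh
    by (intro selection_error[OF n \<omega> conc])
      (auto simp: nearest_selection_def m_hat_selection_def is_arg_min_def)
  have "\<rho>\<^sup>2 * (nbhd_dist M W (\<omega> i) (\<omega> j))\<^sup>2 = \<rho>\<^sup>2 * overlap (\<omega> i) (\<omega> i) +
      \<rho>\<^sup>2 * overlap (\<omega> j) (\<omega> j) - 2 * (\<rho>\<^sup>2 * overlap (\<omega> i) (\<omega> j))"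
    unfolding nbhd_dist_sq[OF latent_space[OF \<omega> ij(1)] latent_space[OF \<omega> ij(2)]]
    by (simp add: algebra_simps)
  then show ?thesis
    using sel[OF ij(1)] sel[OF ij(2)] conc[OF ij] unfolding r_hat_sq_def
    by (auto simp: distrib_left)
qed

end

section \<open>Choice of the Chernoff parameters\<close>

text \<open>For \<open>t = 2 * (n - 2) * \<rho>\<^sup>2 * c\<close> the exponent is \<open>- (n - 2) * \<rho>\<^sup>2 * c\<^sup>2\<close>, and \<open>c\<close> is chosen to make it
  \<open>- (49 / 16) * ln n\<close>. The lower bound on \<open>\<rho>\<close> is what keeps this \<open>c\<close> at most 1, the range in which
  \<open>exp c \<le> 1 + c + c\<^sup>2\<close> is available.\<close>

lemma chernoff_parameters:
  fixes n :: nat and \<rho> :: real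
  assumes n: "n \<ge> 3" and \<rho>: "0 < \<rho>" "\<rho> \<le> 1" "\<rho> \<ge> 2 * sqrt (ln (real n) / (real n - 2))"
  obtains c t where "0 < c" "c \<le> 1"
    and "exp ((real n - 2) * \<rho>\<^sup>2 * c\<^sup>2 - c * t) \<le> 1 / real n ^ 3"
    and "(t + 2 * \<rho>\<^sup>2) / real n \<le> 5 * \<rho> * sqrt (ln (real n) / real n)"
proof -
  define L where "L = ln (real n)"
  define N where "N = real n - 2"
  define a where "a = sqrt (L / N)"
  define b where "b = sqrt (L / real n)"
  have "exp 1 \<le> real n" using exp_le n by simp
  then have L: "1 \<le> L" using n by (simp add: L_def ln_ge_iff)
  have N: "0 < N" "N \<le> real n" "0 < real n" using n by (auto simp: N_def)
  have a: "0 < a" "a\<^sup>2 = L / N" using L N by (auto simp: a_def)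
  have b: "0 < b" "b\<^sup>2 = L / real n" using L N by (auto simp: b_def)
  have a\<rho>: "2 * a \<le> \<rho>" using \<rho>(3) by (simp add: a_def L_def N_def)
  have Na: "N * a \<le> real n * b"
  proof (rule power2_le_imp_le)
    have "(N * a)\<^sup>2 = N * (N * a\<^sup>2)" by (simp add: power2_eq_square)
    also have "\<dots> = N * L" using N a by simp
    also have "\<dots> \<le> real n * L" using N L by simp
    also have "\<dots> = real n * (real n * b\<^sup>2)" using N b by simp
    also have "\<dots> = (real n * b)\<^sup>2" by (simp add: power2_eq_square)
    finally show "(N * a)\<^sup>2 \<le> (real n * b)\<^sup>2" .
  qed (use N b in simp)
  \<comment> \<open>Bounds \<open>n * b\<close>, the square root of \<open>n * ln n\<close>, from
    below, so that the correction \<open>2 * \<rho>\<^sup>2\<close> can be absorbed into a multiple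
    of \<open>\<rho> * (n * b)\<close>.\<close>
  have nb: "4 \<le> 3 * (real n * b)"
  proof (rule power2_le_imp_le)
    have "(3 * (real n * b))\<^sup>2 = 9 * (real n * (real n * b\<^sup>2))" by (simp add: power2_eq_square)
    also have "\<dots> = 9 * (real n * L)" using N b by simp
    finally have "(3 * (real n * b))\<^sup>2 = 9 * (real n * L)" .
    moreover have "3 * 1 \<le> real n * L" using n L by (intro mult_mono) auto
    ultimately show "4\<^sup>2 \<le> (3 * (real n * b))\<^sup>2" by simp
  qed (use N b in simp)
  \<comment> \<open>The factor 7/4 has a square of at least 3, as the bound by the inverse cube of
    \<open>n\<close> demands; twice it plus the 3/2 from the correction is exactly 5; and half of it
    is below 1, which gives \<open>c \<le> 1\<close>.\<close>
  define c where "c = 7 / 4 * a / \<rho>"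
  define t where "t = 7 / 2 * N * \<rho> * a"
  show thesis
  proof
    show "0 < c" using a \<rho> by (simp add: c_def)
    show "c \<le> 1" using a\<rho> a(1) \<rho> by (simp add: c_def field_simps)
    have "N * \<rho>\<^sup>2 * c\<^sup>2 - c * t = - (49 / 16) * (N * a\<^sup>2)"
      using \<rho> by (simp add: c_def t_def power2_eq_square field_simps)
    also have "\<dots> = - (49 / 16) * L" using N a by simp
    also have "\<dots> \<le> - (3 * L)" using L by simp
    finally have "exp (N * \<rho>\<^sup>2 * c\<^sup>2 - c * t) \<le> exp (- (3 * L))" by simp
    also have "\<dots> = 1 / real n ^ 3"
      using N exp_of_nat_mult[of 3 L] by (simp add: exp_minus L_def inverse_eq_divide)
    finally show "exp ((real n - 2) * \<rho>\<^sup>2 * c\<^sup>2 - c * t) \<le> 1 / real n ^ 3"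
      by (simp add: N_def)
    have "t + 2 * \<rho>\<^sup>2 \<le> 7 / 2 * \<rho> * (real n * b) + 2 * \<rho> * 1"
    proof (rule add_mono)
      have "t = 7 / 2 * \<rho> * (N * a)" by (simp add: t_def)
      also have "\<dots> \<le> 7 / 2 * \<rho> * (real n * b)" using Na \<rho> by (intro mult_left_mono) auto
      finally show "t \<le> 7 / 2 * \<rho> * (real n * b)" .
      show "2 * \<rho>\<^sup>2 \<le> 2 * \<rho> * 1" using \<rho> by (simp add: power2_eq_square)
    qed
    also have "\<dots> \<le> 7 / 2 * \<rho> * (real n * b) + 2 * \<rho> * (3 / 4 * (real n * b))"
      using nb \<rho> by (intro add_left_mono mult_left_mono) auto
    also have "\<dots> = (5 * \<rho> * b) * real n" by (simp add: algebra_simps)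
    finally show "(t + 2 * \<rho>\<^sup>2) / real n \<le> 5 * \<rho> * sqrt (ln (real n) / real n)"
      using N by (simp add: b_def L_def pos_divide_le_eq)
  qed
qed

section \<open>Measurability of the event and the union bound\<close>

context graphon
begin

lemma nbhd_dist_measurable [measurable (raw)]:
  assumes [measurable]: "f \<in> N \<rightarrow>\<^sub>M M" "g \<in> N \<rightarrow>\<^sub>M M"
  shows "(\<lambda>x. nbhd_dist M W (f x) (g x)) \<in> borel_measurable N"
  unfolding nbhd_dist_def by measurable

text \<open>The event of the theorem. The selections are quantified inside it, so one event covers
  all ways of breaking ties, including those that depend on the outcome.\<close>

definition accurate :: "nat \<Rightarrow> real \<Rightarrow> (nat \<Rightarrow> 'a) \<Rightarrow> (nat \<times> nat \<Rightarrow> bool) \<Rightarrow> bool" where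
  "accurate n \<rho> \<omega> e \<longleftrightarrow>
    (\<forall>m mh. nearest_selection n M W \<omega> m \<longrightarrow> m_hat_selection n (adjacency e) mh \<longrightarrow>
      (\<forall>i\<in>{1..n}. \<forall>j\<in>{1..n}. i \<noteq> j \<longrightarrow>
        \<bar>\<rho>\<^sup>2 * (nbhd_dist M W (\<omega> i) (\<omega> j))\<^sup>2 - r_hat_sq n (adjacency e) mh i j\<bar>
          \<le> 3 * \<rho> * (\<rho> * nbhd_dist M W (\<omega> j) (\<omega> (m j)) + \<rho> * nbhd_dist M W (\<omega> i) (\<omega> (m i))
              + 20 * sqrt (ln (real n) / real n))))"

text \<open>Only the values of a selection on \<open>{1..n}\<close> matter, so finitely many selections suffice; this
  makes the event measurable.\<close>

lemma accurate_iff_finite: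
  "accurate n \<rho> \<omega> e \<longleftrightarrow>
    (\<forall>m\<in>{1..n} \<rightarrow>\<^sub>E {1..n}. \<forall>mh\<in>{1..n} \<rightarrow>\<^sub>E {1..n}.
      (\<forall>i\<in>{1..n}. m i \<noteq> i \<and> (\<forall>l\<in>{1..n} - {i}. nbhd_dist M W (\<omega> i) (\<omega> (m i)) \<le> nbhd_dist M W (\<omega> i) (\<omega> l)))
      \<longrightarrow> m_hat_selection n (adjacency e) mh \<longrightarrow>
      (\<forall>i\<in>{1..n}. \<forall>j\<in>{1..n}. i \<noteq> j \<longrightarrow>
        \<bar>\<rho>\<^sup>2 * (nbhd_dist M W (\<omega> i) (\<omega> j))\<^sup>2 - r_hat_sq n (adjacency e) mh i j\<bar>
          \<le> 3 * \<rho> * (\<rho> * nbhd_dist M W (\<omega> j) (\<omega> (m j)) + \<rho> * nbhd_dist M W (\<omega> i) (\<omega> (m i))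
              + 20 * sqrt (ln (real n) / real n))))"
    (is "_ = (\<forall>m\<in>?X. \<forall>mh\<in>?X. ?N m \<longrightarrow> ?H mh \<longrightarrow> (\<forall>i\<in>{1..n}. \<forall>j\<in>{1..n}. i \<noteq> j \<longrightarrow> ?R m mh i j))")
proof -
  let ?Q = "\<lambda>m mh. \<forall>i\<in>{1..n}. \<forall>j\<in>{1..n}. i \<noteq> j \<longrightarrow> ?R m mh i j"
  have N: "nearest_selection n M W \<omega> m \<longleftrightarrow> ?N m" if "m \<in> ?X" for m
  proof -
    have "m i \<in> {1..n}" if "i \<in> {1..n}" for i using \<open>m \<in> ?X\<close> that by blast
    then show ?thesis
      by (auto simp: nearest_selection_def is_arg_min_def not_less Ball_def)
  qed
  have restrict: "restrict m {1..n} \<in> ?X" "restrict mh {1..n} \<in> ?X"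
      "nearest_selection n M W \<omega> (restrict m {1..n})" "?H (restrict mh {1..n})"
      "?Q (restrict m {1..n}) (restrict mh {1..n}) \<longleftrightarrow> ?Q m mh"
    if "nearest_selection n M W \<omega> m" "?H mh" for m mh
    using that by (auto simp: nearest_selection_def m_hat_selection_def is_arg_min_def r_hat_sq_def)
  show ?thesis
    unfolding accurate_def
  proof (intro iffI ballI allI impI)
    fix m mh i j
    assume "\<forall>m mh. nearest_selection n M W \<omega> m \<longrightarrow> ?H mh \<longrightarrow> ?Q m mh"
      and "m \<in> ?X" "?N m" "?H mh" "i \<in> {1..n}" "j \<in> {1..n}" "i \<noteq> j"
    then show "?R m mh i j" using N[of m] by blast
  next
    fix m mh i j
    assume fin: "\<forall>m\<in>?X. \<forall>mh\<in>?X. ?N m \<longrightarrow> ?H mh \<longrightarrow> ?Q m mh"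
      and sel: "nearest_selection n M W \<omega> m" "?H mh" and ij: "i \<in> {1..n}" "j \<in> {1..n}" "i \<noteq> j"
    have "?N (restrict m {1..n})" using N restrict(1,3)[OF sel] by blast
    then have "?Q (restrict m {1..n}) (restrict mh {1..n})"
      using fin restrict(1,2,4)[OF sel] by blast
    then show "?R m mh i j" using restrict(5)[OF sel] ij by blast
  qed
qed

text \<open>The edge space is finite and discrete, so the event is a finite union of rectangles, one
  for each configuration \<open>e\<close>. For fixed \<open>e\<close>,
  \<open>accurate_iff_finite\<close> makes the section a finite Boolean combination of inequalities
  between measurable functions of the positions and of conditions constant in them.\<close>

lemma accurate_measurable:
  "{(\<omega>, e) \<in> space (sparse_graphon_measure n M W \<rho>). accurate n \<rho> \<omega> e}
    \<in> sets (sparse_graphon_measure n M W \<rho>)"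
proof -
  let ?E = "node_pairs n \<rightarrow>\<^sub>E (UNIV :: bool set)"
  have "{\<omega> \<in> space (latent n). accurate n \<rho> \<omega> e} \<in> sets (latent n)" for e
  proof -
    have fin: "finite ({1..n} \<rightarrow>\<^sub>E {1..n} :: (nat \<Rightarrow> nat) set)" by (intro finite_PiE) auto
    show ?thesis
      unfolding accurate_iff_finite
    proof (intro sets.sets_Collect_finite_All sets.sets_Collect_imp sets.sets_Collect_conj
        sets.sets_Collect_const finite_Diff fin finite_atLeastAtMost)
      fix m mh :: "nat \<Rightarrow> nat" and i j
      assume m: "m \<in> {1..n} \<rightarrow>\<^sub>E {1..n}" and ij: "i \<in> {1..n}" "j \<in> {1..n}"
      then have [measurable]: "m i \<in> {1..n}" "m j \<in> {1..n}" by (blast dest: PiE_mem)+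
      note [measurable] = ij
      show "{\<omega> \<in> space (latent n). \<bar>\<rho>\<^sup>2 * (nbhd_dist M W (\<omega> i) (\<omega> j))\<^sup>2 - r_hat_sq n (adjacency e) mh i j\<bar>
          \<le> 3 * \<rho> * (\<rho> * nbhd_dist M W (\<omega> j) (\<omega> (m j)) + \<rho> * nbhd_dist M W (\<omega> i) (\<omega> (m i))
              + 20 * sqrt (ln (real n) / real n))} \<in> sets (latent n)"
        by measurable
    next
      fix m :: "nat \<Rightarrow> nat" and i l
      assume m: "m \<in> {1..n} \<rightarrow>\<^sub>E {1..n}" and i: "i \<in> {1..n}" and l: "l \<in> {1..n} - {i}"
      then have [measurable]: "m i \<in> {1..n}" "l \<in> {1..n}" by (blast dest: PiE_mem)+
      note [measurable] = i
      show "{\<omega> \<in> space (latent n). nbhd_dist M W (\<omega> i) (\<omega> (m i)) \<le> nbhd_dist M W (\<omega> i) (\<omega> l)}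
          \<in> sets (latent n)"
        by measurable
    qed
  qed
  then have "(\<Union>e\<in>?E. {\<omega> \<in> space (latent n). accurate n \<rho> \<omega> e} \<times> {e})
      \<in> sets (latent n \<Otimes>\<^sub>M edge_space n)"
    by (intro sets.finite_UN pair_measureI finite_PiE finite_node_pairs)
      (auto simp: edge_space_eq)
  also have "(\<Union>e\<in>?E. {\<omega> \<in> space (latent n). accurate n \<rho> \<omega> e} \<times> {e}) =
      {(\<omega>, e) \<in> space (sparse_graphon_measure n M W \<rho>). accurate n \<rho> \<omega> e}"
    unfolding space_sparse by (auto simp: edge_space_eq)
  finally show ?thesis unfolding sets_sparse .
qed

text \<open>The count is centred at \<open>(n - 2) * p\<close> but divided by \<open>n\<close>;
  recentring at \<open>n * p\<close> costs \<open>2 * p \<le> 2 * \<rho>\<^sup>2\<close>, the extra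
  term in the assumption on \<open>t\<close>.\<close>

lemma accurateI:
  assumes n: "n \<ge> 3" and \<rho>: "0 < \<rho>" and \<omega>: "\<omega> \<in> space (latent n)"
    and t: "(t + 2 * \<rho>\<^sup>2) / real n \<le> 5 * \<rho> * sqrt (ln (real n) / real n)"
    and dev: "\<And>i j. i \<in> {1..n} \<Longrightarrow> j \<in> {1..n} \<Longrightarrow> i \<noteq> j \<Longrightarrow>
      \<bar>common_nbrs n e i j - (real n - 2) * (\<rho>\<^sup>2 * overlap (\<omega> i) (\<omega> j))\<bar> \<le> t"
  shows "accurate n \<rho> \<omega> e"
  unfolding accurate_def
proof (intro allI impI ballI)
  fix m mh i j
  assume m: "nearest_selection n M W \<omega> m" and mh: "m_hat_selection n (adjacency e) mh"
    and ij: "i \<in> {1..n}" "j \<in> {1..n}" "i \<noteq> j"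
  let ?b = "sqrt (ln (real n) / real n)"
  let ?d = "nbhd_dist M W (\<omega> j) (\<omega> (m j)) + nbhd_dist M W (\<omega> i) (\<omega> (m i))"
  have "\<bar>\<rho>\<^sup>2 * (nbhd_dist M W (\<omega> i) (\<omega> j))\<^sup>2 - r_hat_sq n (adjacency e) mh i j\<bar>
      \<le> 2 * \<rho>\<^sup>2 * ?d + 12 * (5 * \<rho> * ?b)"
  proof (rule r_hat_sq_error[OF n \<omega> _ m mh ij])
    fix k l assume kl: "k \<in> {1..n}" "l \<in> {1..n}" "k \<noteq> l"
    define p where "p = \<rho>\<^sup>2 * overlap (\<omega> k) (\<omega> l)"
    have p: "0 \<le> p" "p \<le> \<rho>\<^sup>2"
      using overlap_bounds[OF latent_space[OF \<omega> kl(1)] latent_space[OF \<omega> kl(2)]]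
      by (auto simp: p_def mult_left_le)
    have "\<bar>common_nbrs n e k l - real n * p\<bar> \<le> t + 2 * \<rho>\<^sup>2"
      using dev[OF kl, folded p_def] p by (simp add: left_diff_distrib abs_le_iff)
    moreover have "inner_n n (adjacency e k) (adjacency e l) - p = (common_nbrs n e k l - real n * p) / real n"
      using n by (simp add: inner_n_adjacency[OF kl(1,2)] diff_divide_distrib)
    ultimately have "\<bar>inner_n n (adjacency e k) (adjacency e l) - p\<bar> \<le> (t + 2 * \<rho>\<^sup>2) / real n"
      by (simp add: divide_right_mono)
    then show "\<bar>inner_n n (adjacency e k) (adjacency e l) - \<rho>\<^sup>2 * overlap (\<omega> k) (\<omega> l)\<bar> \<le> 5 * \<rho> * ?b"
      using t by (simp add: p_def)
  qed
  \<comment> \<open>The 2 is raised to 3 to bring out the common factor \<open>3 * \<rho>\<close>;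
    the noise term fits exactly, as 12 * 5 = 3 * 20.\<close>
  also have "\<dots> \<le> 3 * \<rho>\<^sup>2 * ?d + 12 * (5 * \<rho> * ?b)"
    using nbhd_dist_nonneg by (intro add_right_mono mult_right_mono) auto
  also have "\<dots> = 3 * \<rho> * (\<rho> * nbhd_dist M W (\<omega> j) (\<omega> (m j)) + \<rho> * nbhd_dist M W (\<omega> i) (\<omega> (m i)) + 20 * ?b)"
    by (simp add: algebra_simps power2_eq_square)
  finally show "\<bar>\<rho>\<^sup>2 * (nbhd_dist M W (\<omega> i) (\<omega> j))\<^sup>2 - r_hat_sq n (adjacency e) mh i j\<bar>
      \<le> 3 * \<rho> * (\<rho> * nbhd_dist M W (\<omega> j) (\<omega> (m j)) + \<rho> * nbhd_dist M W (\<omega> i) (\<omega> (m i)) + 20 * ?b)" .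
qed

text \<open>Union bound over ordered pairs and both tails: at most \<open>2 * n ^ 2\<close> bad
  events of probability at most \<open>1 / n ^ 3\<close> each.\<close>

lemma prob_accurate:
  assumes n: "n \<ge> 3" and \<rho>: "0 < \<rho>" "\<rho> \<le> 1" "\<rho> \<ge> 2 * sqrt (ln (real n) / (real n - 2))"
  shows "measure (sparse_graphon_measure n M W \<rho>)
      {(\<omega>, e) \<in> space (sparse_graphon_measure n M W \<rho>). accurate n \<rho> \<omega> e} \<ge> 1 - 2 / real n"
proof -
  let ?D = "sparse_graphon_measure n M W \<rho>"
  let ?G = "{(\<omega>, e) \<in> space ?D. accurate n \<rho> \<omega> e}"
  have \<rho>': "0 \<le> \<rho>" "\<rho> \<le> 1" using \<rho> by auto
  interpret D: prob_space ?D by (rule prob_space_sparse[OF \<rho>'])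
  obtain c t where c: "0 < c" "c \<le> 1"
    and ct: "exp ((real n - 2) * \<rho>\<^sup>2 * c\<^sup>2 - c * t) \<le> 1 / real n ^ 3"
    and t: "(t + 2 * \<rho>\<^sup>2) / real n \<le> 5 * \<rho> * sqrt (ln (real n) / real n)"
    using chernoff_parameters[OF n \<rho>] by blast
  \<comment> \<open>The last index \<open>s\<close> is \<open>c\<close> or \<open>- c\<close>, for a
    count too large or too small.\<close>
  define B where "B = (\<lambda>((i, j), s). {(\<omega>, e) \<in> space ?D. c * t \<le>
    s * (common_nbrs n e i j - (real n - 2) * (\<rho>\<^sup>2 * overlap (\<omega> i) (\<omega> j)))})"
  define Q where "Q = {(i, j) \<in> {1..n} \<times> {1..n}. i \<noteq> j} \<times> {c, - c}"
  have finQ: "finite Q"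
    unfolding Q_def
    by (intro finite_cartesian_product) (auto intro: finite_subset[of _ "{1..n} \<times> {1..n}"])
  have "card {(i, j) \<in> {1..n} \<times> {1..n}. i \<noteq> j} \<le> card ({1..n} \<times> {1..n})"
    by (intro card_mono) auto
  then have cardQ: "real (card Q) \<le> 2 * real n ^ 2"
    using c by (simp add: Q_def card_cartesian_product power2_eq_square flip: of_nat_mult)
  have Bsets: "B q \<in> sets ?D" if "q \<in> Q" for q
  proof -
    obtain i j s where q: "q = ((i, j), s)" by (metis prod.exhaust)
    then have [measurable]: "i \<in> {1..n}" "j \<in> {1..n}" using that by (auto simp: Q_def)
    have "{x \<in> space (latent n \<Otimes>\<^sub>M edge_space n). c * t \<le> s * (common_nbrs n (snd x) i j -
        (real n - 2) * (\<rho>\<^sup>2 * overlap (fst x i) (fst x j)))} \<in> sets (latent n \<Otimes>\<^sub>M edge_space n)"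
      by measurable
    also have "{x \<in> space (latent n \<Otimes>\<^sub>M edge_space n). c * t \<le> s * (common_nbrs n (snd x) i j -
        (real n - 2) * (\<rho>\<^sup>2 * overlap (fst x i) (fst x j)))} = B q"
      by (auto simp: B_def q space_sparse space_pair_measure)
    finally show ?thesis unfolding sets_sparse .
  qed
  have "D.prob (space ?D - ?G) \<le> D.prob (\<Union>q\<in>Q. B q)"
  proof (rule D.finite_measure_mono)
    show "(\<Union>q\<in>Q. B q) \<in> sets ?D" using finQ Bsets by (intro sets.finite_UN) auto
    show "space ?D - ?G \<subseteq> (\<Union>q\<in>Q. B q)"
    proof (rule subsetI, rule ccontr)
      fix x assume x: "x \<in> space ?D - ?G" and nB: "x \<notin> (\<Union>q\<in>Q. B q)"
      obtain \<omega> e where xe: "x = (\<omega>, e)" by (metis prod.exhaust)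
      have "\<bar>common_nbrs n e i j - (real n - 2) * (\<rho>\<^sup>2 * overlap (\<omega> i) (\<omega> j))\<bar> \<le> t"
        if ij: "i \<in> {1..n}" "j \<in> {1..n}" "i \<noteq> j" for i j
      proof -
        define z where "z = common_nbrs n e i j - (real n - 2) * (\<rho>\<^sup>2 * overlap (\<omega> i) (\<omega> j))"
        have "((i, j), c) \<in> Q" "((i, j), - c) \<in> Q" using ij by (auto simp: Q_def)
        with nB have "x \<notin> B ((i, j), c)" "x \<notin> B ((i, j), - c)" by blast+
        moreover have "x \<in> B ((i, j), s) \<longleftrightarrow> c * t \<le> s * z" for s
          using x by (simp add: B_def xe z_def)
        ultimately have "c * z < c * t" "c * (- z) < c * t" by auto
        then have "z < t" "- z < t" using c by (auto simp only: mult_less_cancel_left_pos)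
        then show ?thesis by (simp add: z_def)
      qed
      then have "accurate n \<rho> \<omega> e"
        using x by (intro accurateI[OF n \<rho>(1) _ t]) (auto simp: xe space_sparse)
      then show False using x by (simp add: xe)
    qed
  qed
  also have "\<dots> \<le> (\<Sum>q\<in>Q. D.prob (B q))"
    using finQ Bsets by (intro D.finite_measure_subadditive_finite) auto
  also have "\<dots> \<le> (\<Sum>q\<in>Q. 1 / real n ^ 3)"
  proof (rule sum_mono)
    fix q assume "q \<in> Q"
    then obtain i j s where q: "q = ((i, j), s)" and ij: "i \<in> {1..n}" "j \<in> {1..n}" "i \<noteq> j"
      and s: "s = c \<or> s = - c"
      by (auto simp: Q_def)
    have "emeasure ?D (B q) \<le> ennreal (exp ((real n - 2) * \<rho>\<^sup>2 * s\<^sup>2 - c * t))"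
      unfolding B_def q prod.case using s c by (intro common_nbrs_chernoff \<rho>' ij) auto
    also have "\<dots> \<le> ennreal (1 / real n ^ 3)"
      using s ct by (intro ennreal_leI) auto
    finally show "D.prob (B q) \<le> 1 / real n ^ 3"
      by (simp add: D.emeasure_eq_measure)
  qed
  also have "\<dots> \<le> (2 * real n ^ 2) * (1 / real n ^ 3)"
    using cardQ by (simp add: divide_right_mono)
  also have "\<dots> = 2 / real n"
    by (simp add: power2_eq_square power3_eq_cube)
  finally show ?thesis
    using D.prob_compl[OF accurate_measurable] by simp
qed

end

theorem corollary19:
  fixes n :: nat and M :: "'a measure" and W :: "'a \<Rightarrow> 'a \<Rightarrow> real" and \<rho> :: real
  assumes "n \<ge> 3"
    and "graphon M W"
    and "0 < \<rho>" and "\<rho> \<le> 1"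
    and "\<rho> \<ge> 2 * sqrt (ln (real n) / (real n - 2))"
  shows "measure (sparse_graphon_measure n M W \<rho>)
    {(\<omega>, e) \<in> space (sparse_graphon_measure n M W \<rho>).
      \<forall>m mh. nearest_selection n M W \<omega> m \<longrightarrow> m_hat_selection n (adjacency e) mh \<longrightarrow>
        (\<forall>i\<in>{1..n}. \<forall>j\<in>{1..n}. i \<noteq> j \<longrightarrow>
          \<bar>\<rho>\<^sup>2 * (nbhd_dist M W (\<omega> i) (\<omega> j))\<^sup>2 - r_hat_sq n (adjacency e) mh i j\<bar>
            \<le> 3 * \<rho> * (\<rho> * nbhd_dist M W (\<omega> j) (\<omega> (m j)) + \<rho> * nbhd_dist M W (\<omega> i) (\<omega> (m i))
                + 20 * sqrt (ln (real n) / real n)))}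
    \<ge> 1 - 2 / real n"
  using graphon.prob_accurate[OF assms(2,1,3-5)]
  unfolding graphon.accurate_def[OF assms(2)] .

end
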